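(* Fix an integer $n\ge 2$. The posets $\mathsf{CTam}_{312}$, $\mathsf{CTam}_{132}$, and $\mathsf{CTam}_{\mathsf{Tree}}$ are finite and self-dual, and they are pairwise isomorphic.
   Context: Fix an integer $n\ge 2$. A translation-invariant total order (TITO) is a total order $\preceq$ on $\mathbb Z$ such that for all $a,b\in\mathbb Z$, $a\preceq b$ if and only if $a+n\preceq b+n$. A reflection index is a pair $(a,b)$ of integers with $a<b$, considered up to simultaneous translation by multiples of $n$. An inversion of a TITO $\preceq$ is a reflection index $(a,b)$ with $b\preceq a$; $\mathrm{Inv}(\preceq)$ is the set of inversions. The cyclic Dyer lattice $\mathsf{CDyer}$ is the set of all TITOs with the partial order (Dyer order) $\preceq_1\,\le\,\preceq_2$ iff $\mathrm{Inv}(\preceq_1)\subseteq\mathrm{Inv}(\preceq_2)$. A TITO is $312$-avoiding if there are no integers $a<b<c$ with $c\preceq a\preceq b$, and $132$-avoiding if there are no integers $a<b<c$ with $a\preceq c\preceq b$. $\mathsf{CTam}_{312}$ (resp. $\mathsf{CTam}_{132}$) is the subposet of $\mathsf{CDyer}$ consisting of $312$-avoiding (resp. $132$-avoiding) TITOs. A binary tree is a (possibly infinite) plane tree in which each node has at most one left child and at most one right child, each node is the (left or right, not both) child of at most one node (its parent, if it exists), and any two nodes have a common ancestor. Ancestors of $v$ are the nodes obtained from $v$ by taking parents $k\ge0$ times; $v$ is then a descendant. The left (right) subtree of $v$ consists of the descendants of its left (right) child. The in-order is the unique total order on nodes in which, for every node $v$, all nodes of the left subtree of $v$ precede $v$,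 which precedes all nodes of the right subtree of $v$. The post-order is the unique total order in which, for every node $v$, all nodes of the left subtree of $v$ precede all nodes of the right subtree of $v$, which precede $v$. A translation-invariant binary in-ordered tree (TIBIT) is a binary tree $T$ with node set $\{v_a\mid a\in\mathbb Z\}$ such that for distinct $a,b$, $a<b$ iff $v_a$ precedes $v_b$ in in-order, and such that $v_a$ is the left (resp. right) child of $v_b$ iff $v_{a+n}$ is the left (resp. right) child of $v_{b+n}$. For a TIBIT $T$, let $\sqsubseteq_T$ be the ($312$-avoiding) TITO obtained by reading the indices of nodes of $T$ in post-order. $\mathsf{CTam}_{\mathsf{Tree}}$ is the set of TIBITs with the partial order $T_1\le T_2$ iff $\sqsubseteq_{T_1}\,\le\,\sqsubseteq_{T_2}$ in the Dyer order. A poset is self-dual if it is isomorphic to its dual. *)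

theory Defs
  imports Main
begin

section \<open>Translation-invariant total orders and the cyclic Dyer lattice\<close>

text \<open>
  A total order \<open>r\<close> is a set of pairs, with \<open>(a, b) \<in> r\<close> read as ``\<open>a\<close> is weakly before \<open>b\<close>''.
\<close>

definition CDyer :: "int \<Rightarrow> int rel set" where
  "CDyer n = {r. linear_order r \<and> (\<forall>a b. (a, b) \<in> r \<longleftrightarrow> (a + n, b + n) \<in> r)}"

definition translation_rel :: "int \<Rightarrow> (int \<times> int) rel" where
  "translation_rel n =
    {((a, b), (c, d)) | a b c d. a < b \<and> (\<exists>k. c = a + k * n \<and> d = b + k * n)}"

definition reflection_indices :: "int \<Rightarrow> (int \<times> int) set set" where
  "reflection_indices n = {(a, b). a < b} // translation_rel n"

definition Inv :: "int \<Rightarrow> int rel \<Rightarrow> (int \<times> int) set set" where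
  "Inv n r = {X \<in> reflection_indices n. \<exists>(a, b)\<in>X. (b, a) \<in> r}"

definition dyer_order :: "int \<Rightarrow> int rel rel" where
  "dyer_order n = {(r, s). r \<in> CDyer n \<and> s \<in> CDyer n \<and> Inv n r \<subseteq> Inv n s}"

definition avoids_312 :: "int rel \<Rightarrow> bool" where
  "avoids_312 r \<longleftrightarrow> \<not> (\<exists>a b c. a < b \<and> b < c \<and> (c, a) \<in> r \<and> (a, b) \<in> r)"

definition avoids_132 :: "int rel \<Rightarrow> bool" where
  "avoids_132 r \<longleftrightarrow> \<not> (\<exists>a b c. a < b \<and> b < c \<and> (a, c) \<in> r \<and> (c, b) \<in> r)"

definition CTam312 :: "int \<Rightarrow> int rel set" where
  "CTam312 n = {r \<in> CDyer n. avoids_312 r}"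

definition CTam132 :: "int \<Rightarrow> int rel set" where
  "CTam132 n = {r \<in> CDyer n. avoids_132 r}"

definition ctam312_order :: "int \<Rightarrow> int rel rel" where
  "ctam312_order n = Restr (dyer_order n) (CTam312 n)"

definition ctam132_order :: "int \<Rightarrow> int rel rel" where
  "ctam132_order n = Restr (dyer_order n) (CTam132 n)"


section \<open>Binary trees, in-order and post-order\<close>

text \<open>The nodes of a tree of type \<open>'a bintree\<close> are all the elements of type \<open>'a\<close>.\<close>

record 'a bintree =
  lchild :: "'a \<Rightarrow> 'a option"
  rchild :: "'a \<Rightarrow> 'a option"

definition parent_rel :: "'a bintree \<Rightarrow> 'a rel" where
  "parent_rel T = {(u, v). lchild T v = Some u \<or> rchild T v = Some u}"

text \<open>\<open>(u, v) \<in> anc_rel T\<close>: the node \<open>v\<close> is an ancestor of \<open>u\<close> (possibly \<open>u\<close> itself).\<close>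

definition anc_rel :: "'a bintree \<Rightarrow> 'a rel" where
  "anc_rel T = (parent_rel T)\<^sup>*"

text \<open>Acyclicity does not follow from the other clauses: on a single directed cycle, all of them hold.\<close>

definition binary_tree :: "'a bintree \<Rightarrow> bool" where
  "binary_tree T \<longleftrightarrow>
    (\<forall>u v w. (u, v) \<in> parent_rel T \<and> (u, w) \<in> parent_rel T \<longrightarrow> v = w) \<and>
    (\<forall>u v. \<not> (lchild T v = Some u \<and> rchild T v = Some u)) \<and>
    acyclic (parent_rel T) \<and>
    (\<forall>u v. \<exists>w. (u, w) \<in> anc_rel T \<and> (v, w) \<in> anc_rel T)"

definition left_subtree :: "'a bintree \<Rightarrow> 'a \<Rightarrow> 'a set" where
  "left_subtree T v = {u. \<exists>c. lchild T v = Some c \<and> (u, c) \<in> anc_rel T}"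

definition right_subtree :: "'a bintree \<Rightarrow> 'a \<Rightarrow> 'a set" where
  "right_subtree T v = {u. \<exists>c. rchild T v = Some c \<and> (u, c) \<in> anc_rel T}"

definition is_in_order :: "'a bintree \<Rightarrow> 'a rel \<Rightarrow> bool" where
  "is_in_order T r \<longleftrightarrow> linear_order r \<and>
    (\<forall>v. (\<forall>u\<in>left_subtree T v. (u, v) \<in> r) \<and> (\<forall>w\<in>right_subtree T v. (v, w) \<in> r))"

text \<open>
  ``Left subtree, then right subtree, then \<open>v\<close>'': the nodes of the left subtree
  precede \<open>v\<close> also if the right subtree is empty.
\<close>

definition is_post_order :: "'a bintree \<Rightarrow> 'a rel \<Rightarrow> bool" where
  "is_post_order T r \<longleftrightarrow> linear_order r \<and>
    (\<forall>v. (\<forall>u\<in>left_subtree T v. \<forall>w\<in>right_subtree T v. (u, w) \<in> r) \<and>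
         (\<forall>u\<in>left_subtree T v. (u, v) \<in> r) \<and>
         (\<forall>w\<in>right_subtree T v. (w, v) \<in> r))"

definition in_order :: "'a bintree \<Rightarrow> 'a rel" where
  "in_order T = (THE r. is_in_order T r)"

definition post_order :: "'a bintree \<Rightarrow> 'a rel" where
  "post_order T = (THE r. is_post_order T r)"


section \<open>Translation-invariant binary in-ordered trees\<close>

text \<open>The node \<open>v\<^sub>a\<close> is represented by its index \<open>a\<close>.\<close>

definition CTamTree :: "int \<Rightarrow> int bintree set" where
  "CTamTree n = {T. binary_tree T \<and>
    (\<forall>a b. a \<noteq> b \<longrightarrow> (a < b \<longleftrightarrow> (a, b) \<in> in_order T)) \<and>
    (\<forall>a b. lchild T b = Some a \<longleftrightarrow> lchild T (b + n) = Some (a + n)) \<and>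
    (\<forall>a b. rchild T b = Some a \<longleftrightarrow> rchild T (b + n) = Some (a + n))}"

definition ctam_tree_order :: "int \<Rightarrow> int bintree rel" where
  "ctam_tree_order n =
    {(S, T). S \<in> CTamTree n \<and> T \<in> CTamTree n \<and> (post_order S, post_order T) \<in> dyer_order n}"


section \<open>Isomorphism and self-duality of posets\<close>

definition poset_isomorphic :: "'a set \<Rightarrow> 'a rel \<Rightarrow> 'b set \<Rightarrow> 'b rel \<Rightarrow> bool" where
  "poset_isomorphic A r B s \<longleftrightarrow>
    (\<exists>f. bij_betw f A B \<and> (\<forall>x\<in>A. \<forall>y\<in>A. (x, y) \<in> r \<longleftrightarrow> (f x, f y) \<in> s))"

definition self_dual :: "'a set \<Rightarrow> 'a rel \<Rightarrow> bool" where
  "self_dual A r \<longleftrightarrow> poset_isomorphic A r A (r\<inverse>)"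

section \<open>Well-definedness of the Dyer order, the in-order and the post-order\<close>

lemma CDyer_translate:
  assumes "r \<in> CDyer n"
  shows "(a + k * n, b + k * n) \<in> r \<longleftrightarrow> (a, b) \<in> r"
proof -
  have st: "(x, y) \<in> r \<longleftrightarrow> (x + n, y + n) \<in> r" for x y using assms unfolding CDyer_def by blast
  have nat: "(x + int m * n, y + int m * n) \<in> r \<longleftrightarrow> (x, y) \<in> r" for m x y
  proof (induction m)
    case (Suc m)
    have "(x + int (Suc m) * n, y + int (Suc m) * n) = (x + int m * n + n, y + int m * n + n)"
      by (simp add: algebra_simps)
    then show ?case using Suc st[of "x + int m * n" "y + int m * n"] by (simp only:)
  qed simp
  show ?thesis
  proof (cases "k \<ge> 0")
    case True then show ?thesis using nat[of a "nat k" b] by simp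
  next
    case False
    then show ?thesis using nat[of "a + k * n" "nat (- k)" "b + k * n"] by simp
  qed
qed

lemma class_mem_Inv_iff:
  assumes "r \<in> CDyer n" "a < b"
  shows "translation_rel n `` {(a, b)} \<in> Inv n r \<longleftrightarrow> (b, a) \<in> r"
proof -
  have "translation_rel n `` {(a, b)} \<in> reflection_indices n"
    using assms(2) unfolding reflection_indices_def by (intro quotientI) simp
  moreover have "(c, d) \<in> translation_rel n `` {(a, b)} \<longleftrightarrow> (\<exists>k. c = a + k * n \<and> d = b + k * n)" for c d
    using assms(2) unfolding translation_rel_def by auto
  moreover have "\<exists>k. a = a + k * n \<and> b = b + k * n" by (rule exI[of _ 0]) simp
  ultimately show ?thesis using CDyer_translate[OF assms(1)] unfolding Inv_def by fastforce
qed

lemma partial_order_dyer: "partial_order_on (CDyer n) (dyer_order n)"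
proof -
  have "r \<subseteq> s" if rs: "r \<in> CDyer n" "s \<in> CDyer n" and eq: "Inv n r = Inv n s" for r s
  proof (rule subrelI)
    fix x y assume xy: "(x, y) \<in> r"
    have lr: "linear_order r" "linear_order s" using rs unfolding CDyer_def by auto
    consider "y < x" | "x = y" | "x < y" by linarith
    then show "(x, y) \<in> s"
    proof cases
      case 1 then show ?thesis using class_mem_Inv_iff[OF rs(1) 1] class_mem_Inv_iff[OF rs(2) 1] eq xy by simp
    next
      case 2 then show ?thesis using lr(2)
        by (simp add: linear_order_on_def partial_order_on_def preorder_on_def refl_on_def)
    next
      case 3
      then have "(y, x) \<notin> r" using xy lr(1)
        by (auto simp: linear_order_on_def partial_order_on_def dest: antisymD)
      then have "(y, x) \<notin> s" using class_mem_Inv_iff[OF rs(1) 3] class_mem_Inv_iff[OF rs(2) 3] eq by simp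
      then show ?thesis using lr(2) 3 by (metis UNIV_I less_irrefl linear_order_on_def total_on_def)
    qed
  qed
  then show ?thesis
    unfolding partial_order_on_def preorder_on_def refl_on_def trans_def antisym_def dyer_order_def by blast
qed

lemma subtree_cases:
  assumes "(u, v) \<in> anc_rel T" "u \<noteq> v"
  shows "u \<in> left_subtree T v \<or> u \<in> right_subtree T v"
proof -
  have "\<exists>c. (u,c) \<in> (parent_rel T)\<^sup>* \<and> (c,v) \<in> parent_rel T"
    using assms unfolding anc_rel_def by (meson rtranclE)
  then show ?thesis unfolding parent_rel_def left_subtree_def right_subtree_def anc_rel_def by blast
qed

lemma subtree_anc: "u \<in> left_subtree T v \<or> u \<in> right_subtree T v \<Longrightarrow> (u, v) \<in> anc_rel T"
  unfolding left_subtree_def right_subtree_def anc_rel_def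
  by (auto simp: parent_rel_def intro: rtrancl.rtrancl_into_rtrancl)

lemma anc_chain:
  assumes "binary_tree T" "(u, v) \<in> anc_rel T" "(u, w) \<in> anc_rel T"
  shows "(v, w) \<in> anc_rel T \<or> (w, v) \<in> anc_rel T"
proof -
  have "single_valued (parent_rel T)" using assms unfolding binary_tree_def single_valued_def by blast
  then show ?thesis using assms(2,3) unfolding anc_rel_def by (metis single_valued_confluent)
qed

lemma not_in_own_subtree:
  assumes "binary_tree T" shows "v \<notin> left_subtree T v" "v \<notin> right_subtree T v"
proof -
  have "(v,v) \<notin> (parent_rel T)\<^sup>+" using assms unfolding binary_tree_def acyclic_def by blast
  then show "v \<notin> left_subtree T v" "v \<notin> right_subtree T v"
    unfolding left_subtree_def right_subtree_def anc_rel_def parent_rel_def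
    by (auto dest!: rtrancl_into_trancl1)
qed

lemma subtree_trans:
  assumes "(u, v) \<in> anc_rel T"
  shows "v \<in> left_subtree T w \<Longrightarrow> u \<in> left_subtree T w" "v \<in> right_subtree T w \<Longrightarrow> u \<in> right_subtree T w"
  using assms unfolding left_subtree_def right_subtree_def anc_rel_def by (auto dest: rtrancl_trans)

lemma subtrees_disjoint:
  assumes B: "binary_tree T" "u \<in> left_subtree T v" shows "u \<notin> right_subtree T v"
proof
  assume "u \<in> right_subtree T v"
  then obtain c d where c: "lchild T v = Some c" "(u,c) \<in> anc_rel T" and d: "rchild T v = Some d" "(u,d) \<in> anc_rel T"
    using B(2) unfolding left_subtree_def right_subtree_def by blast
  have cd: "c \<noteq> d" using B(1) c(1) d(1) unfolding binary_tree_def by blast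
  have pc: "(c,v) \<in> parent_rel T" and pd: "(d,v) \<in> parent_rel T" using c d unfolding parent_rel_def by auto
  have *: "False" if asm: "(x,y) \<in> anc_rel T" "x \<noteq> y" "(x,v) \<in> parent_rel T" "(y,v) \<in> parent_rel T" for x y
  proof -
    obtain z where z: "(x,z) \<in> parent_rel T" "(z,y) \<in> anc_rel T" 
      using asm(1,2) unfolding anc_rel_def by (auto elim: converse_rtranclE)
    then have "z = v" using asm(3) B(1) unfolding binary_tree_def by blast
    then have "(v,v) \<in> (parent_rel T)\<^sup>+" using z asm(4) unfolding anc_rel_def
      by (meson rtrancl_into_trancl1)
    then show False using B(1) unfolding binary_tree_def acyclic_def by blast
  qed
  show False using anc_chain[OF B(1) c(2) d(2)] * cd pc pd by metis
qed

lemma lca_cases: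
  assumes B: "binary_tree T"
  shows "(u, v) \<in> anc_rel T \<or> (v, u) \<in> anc_rel T \<or>
    (\<exists>w. u \<in> left_subtree T w \<and> v \<in> right_subtree T w) \<or>
    (\<exists>w. v \<in> left_subtree T w \<and> u \<in> right_subtree T w)"
proof -
  obtain w where "(u, w) \<in> anc_rel T" "(v, w) \<in> anc_rel T" using B unfolding binary_tree_def by blast
  from this(1) have "(u,w) \<in> (parent_rel T)\<^sup>*" unfolding anc_rel_def .
  then show ?thesis using \<open>(v, w) \<in> anc_rel T\<close>
  proof (induction rule: rtrancl_induct)
    case base then show ?case by blast
  next
    case (step y z)
    show ?case
    proof (cases "v = z \<or> (v,y) \<in> anc_rel T")
      case True
      then show ?thesis
      proof
        assume "v = z" then show ?thesis using step(1,2) unfolding anc_rel_def by (meson rtrancl.rtrancl_into_rtrancl)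
      next
        assume "(v,y) \<in> anc_rel T" then show ?thesis using step by blast
      qed
    next
      case False
      have uy: "(u,y) \<in> anc_rel T" using step(1) unfolding anc_rel_def .
      show ?thesis
        using subtree_cases[OF \<open>(v,z) \<in> anc_rel T\<close>] False step(2) uy
        unfolding left_subtree_def right_subtree_def parent_rel_def by force
    qed
  qed
qed

definition in_before :: "'a bintree \<Rightarrow> 'a \<Rightarrow> 'a \<Rightarrow> bool" where
  "in_before T u v \<longleftrightarrow> u \<in> left_subtree T v \<or> v \<in> right_subtree T u \<or> (\<exists>w. u \<in> left_subtree T w \<and> v \<in> right_subtree T w)"

definition post_before :: "'a bintree \<Rightarrow> 'a \<Rightarrow> 'a \<Rightarrow> bool" where
  "post_before T u v \<longleftrightarrow> u \<in> left_subtree T v \<or> u \<in> right_subtree T v \<or> (\<exists>w. u \<in> left_subtree T w \<and> v \<in> right_subtree T w)"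

lemma in_before_total: "binary_tree T \<Longrightarrow> u \<noteq> v \<Longrightarrow> in_before T u v \<or> in_before T v u"
  using lca_cases[of T u v] subtree_cases[of u v T] subtree_cases[of v u T] unfolding in_before_def by blast

lemma post_before_total: "binary_tree T \<Longrightarrow> u \<noteq> v \<Longrightarrow> post_before T u v \<or> post_before T v u"
  using lca_cases[of T u v] subtree_cases[of u v T] subtree_cases[of v u T] unfolding post_before_def by blast

lemma subtree_comparable:
  assumes B: "binary_tree T" and "(u,v) \<in> anc_rel T" "(u,w) \<in> anc_rel T"
  shows "v = w \<or> v \<in> left_subtree T w \<or> v \<in> right_subtree T w \<or> w \<in> left_subtree T v \<or> w \<in> right_subtree T v"
  using anc_chain[OF assms] subtree_cases by metis

context
  fixes T :: "'a bintree" and L R :: "'a \<Rightarrow> 'a \<Rightarrow> bool"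
  assumes B: "binary_tree T"
  defines "L \<equiv> \<lambda>u v. u \<in> left_subtree T v" and "R \<equiv> \<lambda>u v. u \<in> right_subtree T v"
begin
lemma LR_facts:
  "L u v \<or> R u v \<Longrightarrow> L v w \<Longrightarrow> L u w"
  "L u v \<or> R u v \<Longrightarrow> R v w \<Longrightarrow> R u w"
  "\<not> L u u" "\<not> R u u" "L u v \<Longrightarrow> \<not> R u v"
  "L u v \<or> R u v \<Longrightarrow> L u w \<or> R u w \<Longrightarrow> v = w \<or> L v w \<or> R v w \<or> L w v \<or> R w v"
  unfolding L_def R_def
  using subtree_trans(1)[of u v T w] subtree_trans(2)[of u v T w] subtree_anc[of u T v] subtree_anc[of u T w] not_in_own_subtree[OF B, of u] subtrees_disjoint[OF B, of u v] subtree_comparable[OF B, of u v w]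
  by blast+
lemma in_before_LR: "in_before T u v \<longleftrightarrow> L u v \<or> R v u \<or> (\<exists>w. L u w \<and> R v w)" unfolding in_before_def L_def R_def ..
lemma post_before_LR: "post_before T u v \<longleftrightarrow> L u v \<or> R u v \<or> (\<exists>w. L u w \<and> R v w)" unfolding post_before_def L_def R_def ..

lemma LR_disjoint: "L u v \<Longrightarrow> R u v \<Longrightarrow> P" using LR_facts(5) by blast
lemma LR_trans: "L u v \<Longrightarrow> L v w \<Longrightarrow> L u w" "R u v \<Longrightarrow> L v w \<Longrightarrow> L u w"
  "L u v \<Longrightarrow> R v w \<Longrightarrow> R u w" "R u v \<Longrightarrow> R v w \<Longrightarrow> R u w"
  using LR_facts(1)[of u v w] LR_facts(2)[of u v w] by blast+
lemma LR_split: assumes "L u w" "R v w" "L v x \<or> R v x"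
  shows "x = w \<or> R x w \<or> (L w x \<and> L u x \<and> L v x) \<or> (R w x \<and> R u x \<and> R v x)"
  using LR_facts(6)[of v w x] assms LR_trans[of v x w] LR_trans[of u w x] LR_trans[of v w x] LR_disjoint[of v w False] by argo
lemma LR_split2: assumes "L u w" "R v w" "L u x \<or> R u x"
  shows "x = w \<or> L x w \<or> (L w x \<and> L u x \<and> L v x) \<or> (R w x \<and> R u x \<and> R v x)"
  using LR_facts(6)[of u w x] assms LR_trans[of u x w] LR_trans[of u w x] LR_trans[of v w x] LR_disjoint[of u w False] by argo
lemma in_beforeI_LR: "L a b \<Longrightarrow> in_before T a b" "R b a \<Longrightarrow> in_before T a b" "L a w \<Longrightarrow> R b w \<Longrightarrow> in_before T a b"
  unfolding in_before_LR by blast+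
lemma post_beforeI_LR: "L a b \<Longrightarrow> post_before T a b" "R a b \<Longrightarrow> post_before T a b" "L a w \<Longrightarrow> R b w \<Longrightarrow> post_before T a b"
  unfolding post_before_LR by blast+

lemma in_before_trans: assumes "in_before T a b" "in_before T b c" shows "in_before T a c"
proof -
  consider (1) "L a b" "L b c" | (2) "L a b" "R c b" | (3) w where "L a b" "L b w" "R c w"
    | (4) "R b a" "L b c" | (5) "R b a" "R c b" | (6) w where "R b a" "L b w" "R c w"
    | (7) w where "L a w" "R b w" "L b c" | (8) w where "L a w" "R b w" "R c b"
    | (9) w x where "L a w" "R b w" "L b x" "R c x"
    using assms unfolding in_before_LR by blast
  then show ?thesis
  proof cases
    case 1 then show ?thesis using LR_trans(1)[of a b c] in_beforeI_LR(1)[of a c] by blast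
  next case 2 then show ?thesis using in_beforeI_LR(3)[of a b c] by blast
  next case (3 w) then show ?thesis using LR_trans(1)[of a b w] in_beforeI_LR(3)[of a w c] by blast
  next case 4 then show ?thesis using LR_facts(6)[of b a c] LR_trans[of b a c] LR_trans[of b c a] LR_disjoint[of b a] LR_disjoint[of b c] in_beforeI_LR(1)[of a c] in_beforeI_LR(2)[of c a] by blast
  next case 5 then show ?thesis using LR_trans(4)[of c b a] in_beforeI_LR(2)[of c a] by blast
  next case (6 w) then show ?thesis using LR_split2[OF 6(2,3), of a] LR_disjoint[of b w] LR_disjoint[of b a] LR_trans(4)[of c w a] in_beforeI_LR(2)[of c a] in_beforeI_LR(3)[of a w c] by blast
  next case (7 w) then show ?thesis using LR_split[OF 7(1,2), of c] LR_disjoint[of b w] LR_disjoint[of b c] in_beforeI_LR(1)[of a c] in_beforeI_LR(3)[of a w c] by blast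
  next case (8 w) then show ?thesis using LR_trans(4)[of c b w] in_beforeI_LR(3)[of a w c] by blast
  next case (9 w x) then show ?thesis using LR_split[OF 9(1,2), of x] LR_disjoint[of b w] LR_disjoint[of b x] LR_trans(4)[of c x w] in_beforeI_LR(3)[of a w c] in_beforeI_LR(3)[of a x c] by blast
  qed
qed

lemma post_before_trans: assumes "post_before T a b" "post_before T b c" shows "post_before T a c"
proof -
  consider (1) "L a b \<or> R a b" "L b c \<or> R b c" | (3) w where "L a b \<or> R a b" "L b w" "R c w"
    | (7) w where "L a w" "R b w" "L b c \<or> R b c" 
    | (9) w x where "L a w" "R b w" "L b x" "R c x"
    using assms unfolding post_before_LR by blast
  then show ?thesis
  proof cases
    case 1 then show ?thesis using LR_trans[of a b c] post_beforeI_LR(1,2)[of a c] by blast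
  next case (3 w) then show ?thesis using LR_trans[of a b w] post_beforeI_LR(3)[of a w c] by blast
  next case (7 w) then show ?thesis using LR_split[OF 7(1,2), of c] post_beforeI_LR(1,2)[of a c] post_beforeI_LR(3)[of a w c] by blast
  next case (9 w x) then show ?thesis using LR_split[OF 9(1,2), of x] LR_disjoint[of b w] LR_disjoint[of b x] LR_trans(4)[of c x w] post_beforeI_LR(3)[of a w c] post_beforeI_LR(3)[of a x c] by blast
  qed
qed

lemma in_before_irrefl: "\<not> in_before T a a" unfolding in_before_LR using LR_facts(3,4)[of a] LR_disjoint[of a] by metis
lemma post_before_irrefl: "\<not> post_before T a a" unfolding post_before_LR using LR_facts(3,4)[of a] LR_disjoint[of a] by metis
end

lemma linear_orderI_strict:
  assumes "\<And>a. \<not> P a a" "\<And>a b c. P a b \<Longrightarrow> P b c \<Longrightarrow> P a c" "\<And>a b. a \<noteq> b \<Longrightarrow> P a b \<or> P b a"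
  shows "linear_order {(a,b). a = b \<or> P a b}"
  using assms unfolding linear_order_on_def partial_order_on_def preorder_on_def refl_on_def trans_def antisym_def total_on_def
  by blast

lemma linear_order_subset_eq:
  assumes "linear_order r" "linear_order s" "r \<subseteq> s" shows "s = r"
  using assms unfolding linear_order_on_def partial_order_on_def preorder_on_def refl_on_def antisym_def total_on_def
  by (metis UNIV_I subrelI subset_antisym subset_iff)

lemma is_in_order_exists: assumes B: "binary_tree T" shows "is_in_order T {(a,b). a = b \<or> in_before T a b}"
proof -
  have l: "linear_order {(a,b). a = b \<or> in_before T a b}"
  proof (rule linear_orderI_strict)
    show "\<And>a. \<not> in_before T a a" by (rule in_before_irrefl[OF B])
    show "\<And>a b c. in_before T a b \<Longrightarrow> in_before T b c \<Longrightarrow> in_before T a c" by (rule in_before_trans[OF B])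
    show "\<And>a b. a \<noteq> b \<Longrightarrow> in_before T a b \<or> in_before T b a" by (rule in_before_total[OF B])
  qed
  show ?thesis unfolding is_in_order_def by (rule conjI[OF l]) (auto simp: in_before_def)
qed

lemma in_order_unique: assumes B: "binary_tree T" shows "\<exists>!r. is_in_order T r"
proof (rule ex1I[where P="is_in_order T", OF is_in_order_exists[OF B]])
  fix r assume r: "is_in_order T r"
  have l: "linear_order r" using r unfolding is_in_order_def by blast
  have rf: "(a,a) \<in> r" for a using l unfolding linear_order_on_def partial_order_on_def preorder_on_def refl_on_def by blast
  have tr: "(a,b) \<in> r \<Longrightarrow> (b,c) \<in> r \<Longrightarrow> (a,c) \<in> r" for a b c
    using l unfolding linear_order_on_def partial_order_on_def preorder_on_def by (meson transD)
  have l2: "linear_order {(a,b). a = b \<or> in_before T a b}" using is_in_order_exists[OF B] unfolding is_in_order_def by blast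
  have "(a,b) \<in> r" if "in_before T a b" for a b using that r tr unfolding is_in_order_def in_before_def by metis
  then have "{(a,b). a = b \<or> in_before T a b} \<subseteq> r" using rf by blast
  then show "r = {(a,b). a = b \<or> in_before T a b}" by (rule linear_order_subset_eq[OF l2 l])
qed

lemma is_post_order_exists: assumes B: "binary_tree T" shows "is_post_order T {(a,b). a = b \<or> post_before T a b}"
proof -
  have l: "linear_order {(a,b). a = b \<or> post_before T a b}"
  proof (rule linear_orderI_strict)
    show "\<And>a. \<not> post_before T a a" by (rule post_before_irrefl[OF B])
    show "\<And>a b c. post_before T a b \<Longrightarrow> post_before T b c \<Longrightarrow> post_before T a c" by (rule post_before_trans[OF B])
    show "\<And>a b. a \<noteq> b \<Longrightarrow> post_before T a b \<or> post_before T b a" by (rule post_before_total[OF B])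
  qed
  show ?thesis unfolding is_post_order_def by (rule conjI[OF l]) (auto simp: post_before_def)
qed

lemma post_order_unique: assumes B: "binary_tree T" shows "\<exists>!r. is_post_order T r"
proof (rule ex1I[where P="is_post_order T", OF is_post_order_exists[OF B]])
  fix r assume r: "is_post_order T r"
  have l: "linear_order r" using r unfolding is_post_order_def by blast
  have rf: "(a,a) \<in> r" for a using l unfolding linear_order_on_def partial_order_on_def preorder_on_def refl_on_def by blast
  have tr: "(a,b) \<in> r \<Longrightarrow> (b,c) \<in> r \<Longrightarrow> (a,c) \<in> r" for a b c
    using l unfolding linear_order_on_def partial_order_on_def preorder_on_def by (meson transD)
  have l2: "linear_order {(a,b). a = b \<or> post_before T a b}" using is_post_order_exists[OF B] unfolding is_post_order_def by blast
  have "(a,b) \<in> r" if "post_before T a b" for a b using that r tr unfolding is_post_order_def post_before_def by metis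
  then have "{(a,b). a = b \<or> post_before T a b} \<subseteq> r" using rf by blast
  then show "r = {(a,b). a = b \<or> post_before T a b}" by (rule linear_order_subset_eq[OF l2 l])
qed

lemma is_in_order_in_order: "binary_tree T \<Longrightarrow> is_in_order T (in_order T)"
  unfolding in_order_def by (rule theI') (rule in_order_unique)

lemma is_post_order_post_order: "binary_tree T \<Longrightarrow> is_post_order T (post_order T)"
  unfolding post_order_def by (rule theI') (rule post_order_unique)

end

theory Submission
  imports Defs
begin

text \<open>
  Two facts carry the theorem. The first is that post-order is an isomorphism from trees to
  312-avoiding orders. Its inverse sends an order to its Cartesian tree, in which the descendants
  of \<open>v\<close> form the largest interval of integers in which \<open>v\<close> comes last (\<open>dominated\<close>). For a total
  order on the integers in general, this need not define a tree: infinitely many integers may lie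
  below \<open>v\<close> on one side without a last one among them. For a translation-invariant order, the last
  one exists and lies within distance \<open>n\<close> of \<open>v\<close> (\<open>ex_tree_child\<close>). This bound is also what makes
  every descendant reachable by a finite path (\<open>dominated_subset_anc\<close>) and what leaves only
  finitely many trees (\<open>finite_CTam312\<close>).

  The second fact is that taking mirror images reverses the order on trees. The inversions of a
  post-order are the pairs of a node and a right descendant of it, so \<open>S \<le> T\<close> says that every right
  descendant in \<open>S\<close> is one in \<open>T\<close>. For \<open>a < b\<close>, the lowest common ancestor of \<open>a\<close> and \<open>b\<close> lies
  between them, so \<open>a\<close> is a left descendant of \<open>b\<close> iff \<open>b\<close> is not a right descendant of any \<open>c\<close>
  with \<open>a \<le> c < b\<close>, and symmetrically (\<open>anc_iff_no_ancestor_between\<close>). So more right descendants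
  mean fewer left descendants, and the mirror image exchanges the two.

  Hence trees and 312-avoiding orders form isomorphic self-dual posets. Negating all integers is
  an anti-isomorphism from 312-avoiding to 132-avoiding orders (\<open>CTam312_dual_CTam132\<close>), which
  self-duality turns into an isomorphism.
\<close>

section \<open>Isomorphism of posets\<close>

lemma poset_isomorphic_sym:
  assumes "poset_isomorphic A r B s"
  shows "poset_isomorphic B s A r"
proof -
  obtain f where f: "bij_betw f A B" "\<forall>x\<in>A. \<forall>y\<in>A. (x, y) \<in> r \<longleftrightarrow> (f x, f y) \<in> s"
    using assms unfolding poset_isomorphic_def by blast
  let ?g = "inv_into A f"
  have g: "bij_betw ?g B A" using f(1) by (rule bij_betw_inv_into)
  have "(x, y) \<in> s \<longleftrightarrow> (?g x, ?g y) \<in> r" if "x \<in> B" "y \<in> B" for x y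
    using that f(2) bij_betw_apply[OF g] bij_betw_inv_into_right[OF f(1)] by metis
  then show ?thesis using g unfolding poset_isomorphic_def by blast
qed

lemma poset_isomorphic_trans:
  assumes "poset_isomorphic A r B s" "poset_isomorphic B s C t"
  shows "poset_isomorphic A r C t"
proof -
  obtain f where f: "bij_betw f A B" "\<forall>x\<in>A. \<forall>y\<in>A. (x, y) \<in> r \<longleftrightarrow> (f x, f y) \<in> s"
    using assms(1) unfolding poset_isomorphic_def by blast
  obtain g where g: "bij_betw g B C" "\<forall>x\<in>B. \<forall>y\<in>B. (x, y) \<in> s \<longleftrightarrow> (g x, g y) \<in> t"
    using assms(2) unfolding poset_isomorphic_def by blast
  have "(x, y) \<in> r \<longleftrightarrow> ((g \<circ> f) x, (g \<circ> f) y) \<in> t" if "x \<in> A" "y \<in> A" for x y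
    using that f(2) g(2) bij_betw_apply[OF f(1)] by simp
  then show ?thesis using bij_betw_trans[OF f(1) g(1)] unfolding poset_isomorphic_def by blast
qed

lemma poset_isomorphic_converse:
  "poset_isomorphic A r B s \<Longrightarrow> poset_isomorphic A (r\<inverse>) B (s\<inverse>)"
  unfolding poset_isomorphic_def by fastforce

lemma self_dual_transfer:
  assumes "poset_isomorphic A r B s" "self_dual B s"
  shows "self_dual A r"
  using assms poset_isomorphic_trans poset_isomorphic_sym poset_isomorphic_converse
  unfolding self_dual_def by metis


section \<open>The Dyer order and negation of values\<close>

lemma linear_orderD:
  assumes "linear_order r"
  shows "(a, a) \<in> r"
    and "(a, b) \<in> r \<Longrightarrow> (b, c) \<in> r \<Longrightarrow> (a, c) \<in> r"
    and "(a, b) \<in> r \<Longrightarrow> (b, a) \<in> r \<Longrightarrow> a = b"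
    and "(a, b) \<in> r \<or> (b, a) \<in> r"
  using assms
  unfolding linear_order_on_def partial_order_on_def preorder_on_def refl_on_def trans_def
    antisym_def total_on_def
  by (blast, blast, blast, metis UNIV_I)

lemma dyer_order_iff:
  "(r, s) \<in> dyer_order n \<longleftrightarrow>
    r \<in> CDyer n \<and> s \<in> CDyer n \<and> (\<forall>a b. a < b \<longrightarrow> (b, a) \<in> r \<longrightarrow> (b, a) \<in> s)"
proof (cases "r \<in> CDyer n \<and> s \<in> CDyer n")
  case True
  have "Inv n r \<subseteq> Inv n s \<longleftrightarrow> (\<forall>a b. a < b \<longrightarrow> (b, a) \<in> r \<longrightarrow> (b, a) \<in> s)"
  proof
    assume "Inv n r \<subseteq> Inv n s"
    then show "\<forall>a b. a < b \<longrightarrow> (b, a) \<in> r \<longrightarrow> (b, a) \<in> s"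
      using True class_mem_Inv_iff by blast
  next
    assume sub: "\<forall>a b. a < b \<longrightarrow> (b, a) \<in> r \<longrightarrow> (b, a) \<in> s"
    show "Inv n r \<subseteq> Inv n s"
    proof
      fix X assume X: "X \<in> Inv n r"
      then obtain a b where "a < b" "X = translation_rel n `` {(a, b)}"
        unfolding Inv_def reflection_indices_def quotient_def by blast
      then show "X \<in> Inv n s" using X True sub class_mem_Inv_iff by blast
    qed
  qed
  then show ?thesis using True unfolding dyer_order_def by blast
qed (auto simp: dyer_order_def)

lemma all_less_neg:
  "(\<forall>a b :: int. a < b \<longrightarrow> P a b) \<longleftrightarrow> (\<forall>a b. a < b \<longrightarrow> P (- b) (- a))"
proof (intro iffI allI impI)
  fix a b :: int
  assume "\<forall>a b. a < b \<longrightarrow> P (- b) (- a)" "a < b"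
  then have "P (- (- a)) (- (- b))" by (simp del: minus_minus)
  then show "P a b" by simp
qed simp

definition neg_rel :: "int rel \<Rightarrow> int rel" where
  "neg_rel r = {(a, b). (- a, - b) \<in> r}"

lemma neg_rel_neg_rel [simp]: "neg_rel (neg_rel r) = r"
  unfolding neg_rel_def by simp

lemma neg_rel_in_CDyer:
  assumes "r \<in> CDyer n" shows "neg_rel r \<in> CDyer n"
proof -
  have lin: "linear_order r" using assms unfolding CDyer_def by blast
  have "linear_order (neg_rel r)"
  proof -
    have "refl (neg_rel r)"
      unfolding refl_on_def neg_rel_def using linear_orderD(1)[OF lin] by simp
    moreover have "trans (neg_rel r)"
      unfolding trans_def neg_rel_def using linear_orderD(2)[OF lin] by blast
    moreover have "antisym (neg_rel r)"
      unfolding antisym_def neg_rel_def using linear_orderD(3)[OF lin] by fastforce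
    moreover have "total (neg_rel r)"
      unfolding total_on_def neg_rel_def using linear_orderD(4)[OF lin] by blast
    ultimately show ?thesis
      unfolding linear_order_on_def partial_order_on_def preorder_on_def by simp
  qed
  moreover have "(a, b) \<in> neg_rel r \<longleftrightarrow> (a + n, b + n) \<in> neg_rel r" for a b
    using CDyer_translate[OF assms, of "- a" "-1" "- b"] unfolding neg_rel_def by simp
  ultimately show ?thesis unfolding CDyer_def by blast
qed

lemma avoids_neg_rel:
  "avoids_132 (neg_rel r) \<longleftrightarrow> avoids_312 r"
proof -
  have "(\<exists>a b c. a < b \<and> b < c \<and> (- a, - c) \<in> r \<and> (- c, - b) \<in> r) \<longleftrightarrow>
    (\<exists>a b c. a < b \<and> b < c \<and> (c, a) \<in> r \<and> (a, b) \<in> r)" (is "?L \<longleftrightarrow> ?R")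
  proof
    assume ?L
    then obtain a b c where "a < b" "b < c" "(- a, - c) \<in> r" "(- c, - b) \<in> r" by blast
    then show ?R by (intro exI[of _ "- c"] exI[of _ "- b"] exI[of _ "- a"]) simp
  next
    assume ?R
    then obtain a b c where "a < b" "b < c" "(c, a) \<in> r" "(a, b) \<in> r" by blast
    then show ?L by (intro exI[of _ "- c"] exI[of _ "- b"] exI[of _ "- a"]) simp
  qed
  then show ?thesis unfolding avoids_132_def avoids_312_def neg_rel_def by simp
qed

text \<open>
  Negating all values turns the pattern 312 into 132. A pair \<open>a < b\<close> is inverted after the
  negation iff the pair \<open>- b < - a\<close> is not inverted before it, so the Dyer order is reversed.
\<close>

lemma CTam312_dual_CTam132:
  "poset_isomorphic (CTam312 n) (ctam312_order n) (CTam132 n) ((ctam132_order n)\<inverse>)"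
proof -
  have "bij_betw neg_rel (CTam312 n) (CTam132 n)"
  proof (rule bij_betw_byWitness[where f' = neg_rel])
    show "neg_rel ` CTam312 n \<subseteq> CTam132 n"
      unfolding CTam312_def CTam132_def using neg_rel_in_CDyer avoids_neg_rel by blast
    show "neg_rel ` CTam132 n \<subseteq> CTam312 n"
      unfolding CTam312_def CTam132_def using neg_rel_in_CDyer avoids_neg_rel
      by (auto simp: avoids_neg_rel[symmetric])
  qed simp_all
  moreover have "(r, s) \<in> ctam312_order n \<longleftrightarrow> (neg_rel r, neg_rel s) \<in> (ctam132_order n)\<inverse>"
    if rs: "r \<in> CTam312 n" "s \<in> CTam312 n" for r s
  proof -
    have C: "r \<in> CDyer n" "s \<in> CDyer n" using rs unfolding CTam312_def by auto
    then have lin: "linear_order r" "linear_order s" unfolding CDyer_def by auto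
    have flip: "(a, b) \<in> q \<longleftrightarrow> (b, a) \<notin> q" if "a < b" "linear_order q" for a b :: int and q
      using linear_orderD(3,4)[OF that(2)] that(1) by blast
    have "(\<forall>a b. a < b \<longrightarrow> (b, a) \<in> r \<longrightarrow> (b, a) \<in> s) \<longleftrightarrow>
      (\<forall>a b. a < b \<longrightarrow> (a, b) \<in> s \<longrightarrow> (a, b) \<in> r)"
      using flip lin by blast
    also have "\<dots> \<longleftrightarrow> (\<forall>a b. a < b \<longrightarrow> (- b, - a) \<in> s \<longrightarrow> (- b, - a) \<in> r)"
      by (rule all_less_neg)
    finally have "(\<forall>a b. a < b \<longrightarrow> (b, a) \<in> r \<longrightarrow> (b, a) \<in> s) \<longleftrightarrow>
      (\<forall>a b. a < b \<longrightarrow> (- b, - a) \<in> s \<longrightarrow> (- b, - a) \<in> r)" .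
    moreover have "neg_rel r \<in> CTam132 n" "neg_rel s \<in> CTam132 n"
      using rs neg_rel_in_CDyer avoids_neg_rel unfolding CTam312_def CTam132_def by auto
    ultimately show ?thesis
      using C rs neg_rel_in_CDyer unfolding ctam312_order_def ctam132_order_def
      by (auto simp: dyer_order_iff neg_rel_def)
  qed
  ultimately show ?thesis unfolding poset_isomorphic_def by blast
qed


section \<open>Trees whose in-order is the order of the integers\<close>

definition in_ordered_tree :: "int bintree \<Rightarrow> bool" where
  "in_ordered_tree T \<longleftrightarrow> binary_tree T \<and>
    (\<forall>v. left_subtree T v \<subseteq> {..<v} \<and> right_subtree T v \<subseteq> {v<..})"

lemma is_in_order_le_iff:
  assumes "binary_tree T"
  shows "is_in_order T {(a, b). a \<le> b} \<longleftrightarrow> in_ordered_tree T"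
proof -
  have "linear_order {(a, b). a \<le> (b :: int)}"
    unfolding linear_order_on_def partial_order_on_def preorder_on_def refl_on_def trans_def
      antisym_def total_on_def by auto
  then show ?thesis
    using not_in_own_subtree[OF assms] assms unfolding is_in_order_def in_ordered_tree_def
    by (force simp: order_less_le)
qed

lemma in_ordered_tree_iff_in_order:
  assumes "binary_tree T"
  shows "in_ordered_tree T \<longleftrightarrow> (\<forall>a b. a \<noteq> b \<longrightarrow> (a < b \<longleftrightarrow> (a, b) \<in> in_order T))"
proof
  assume "in_ordered_tree T"
  then have "in_order T = {(a, b). a \<le> b}"
    using is_in_order_le_iff[OF assms] is_in_order_in_order[OF assms] in_order_unique[OF assms]
    by blast
  then show "\<forall>a b. a \<noteq> b \<longrightarrow> (a < b \<longleftrightarrow> (a, b) \<in> in_order T)" by auto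
next
  assume lt: "\<forall>a b. a \<noteq> b \<longrightarrow> (a < b \<longleftrightarrow> (a, b) \<in> in_order T)"
  have "(a, b) \<in> in_order T \<longleftrightarrow> a \<le> b" for a b
    using lt linear_orderD(1) is_in_order_in_order[OF assms] unfolding is_in_order_def
    by (cases "a = b") force+
  then have "in_order T = {(a, b). a \<le> b}" by auto
  then show "in_ordered_tree T"
    using is_in_order_le_iff[OF assms] is_in_order_in_order[OF assms] by simp
qed

lemma in_ordered_tree_child:
  assumes "in_ordered_tree T"
  shows "lchild T v = Some c \<longleftrightarrow> (c, v) \<in> parent_rel T \<and> c < v"
    and "rchild T v = Some c \<longleftrightarrow> (c, v) \<in> parent_rel T \<and> v < c"
proof -
  have l: "c < v" if "lchild T v = Some c" for c
    using assms that unfolding in_ordered_tree_def left_subtree_def anc_rel_def by blast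
  have r: "v < c" if "rchild T v = Some c" for c
    using assms that unfolding in_ordered_tree_def right_subtree_def anc_rel_def by blast
  show "lchild T v = Some c \<longleftrightarrow> (c, v) \<in> parent_rel T \<and> c < v"
    "rchild T v = Some c \<longleftrightarrow> (c, v) \<in> parent_rel T \<and> v < c"
    using l r unfolding parent_rel_def by force+
qed

text \<open>
  Left and right children are told apart by their values, so everything about the tree can be
  said in terms of \<^const>\<open>parent_rel\<close> and \<^const>\<open>anc_rel\<close>, treating both sides at once.
\<close>

lemma CTamTree_iff:
  "T \<in> CTamTree n \<longleftrightarrow> in_ordered_tree T \<and>
    (\<forall>a b. (a, b) \<in> parent_rel T \<longleftrightarrow> (a + n, b + n) \<in> parent_rel T)"
proof
  assume "T \<in> CTamTree n"
  then show "in_ordered_tree T \<and>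
    (\<forall>a b. (a, b) \<in> parent_rel T \<longleftrightarrow> (a + n, b + n) \<in> parent_rel T)"
    unfolding CTamTree_def parent_rel_def using in_ordered_tree_iff_in_order by auto
next
  assume T: "in_ordered_tree T \<and>
    (\<forall>a b. (a, b) \<in> parent_rel T \<longleftrightarrow> (a + n, b + n) \<in> parent_rel T)"
  then have "binary_tree T" unfolding in_ordered_tree_def by blast
  then show "T \<in> CTamTree n"
    unfolding CTamTree_def using T in_ordered_tree_iff_in_order[of T] in_ordered_tree_child[of T]
    by simp
qed

text \<open>
  For fixed \<open>v\<close>, the \<open>u\<close> dominated by \<open>v\<close> form the largest interval in which \<open>v\<close> comes last. When
  \<open>r\<close> is the post-order of a tree, these are the descendants of \<open>v\<close>.
\<close>

definition dominated :: "int rel \<Rightarrow> int rel" where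
  "dominated r = {(u, v). \<forall>c\<in>{min u v..max u v}. (c, v) \<in> r}"

context
  fixes T :: "int bintree"
  assumes T: "in_ordered_tree T"
begin

lemma tree_binary: "binary_tree T"
  using T unfolding in_ordered_tree_def by blast

lemma left_subtree_iff: "u \<in> left_subtree T v \<longleftrightarrow> (u, v) \<in> anc_rel T \<and> u < v"
  and right_subtree_iff: "u \<in> right_subtree T v \<longleftrightarrow> (u, v) \<in> anc_rel T \<and> v < u"
  using T subtree_cases[of u v T] subtree_anc[of u T v] unfolding in_ordered_tree_def by force+

lemma anc_refl: "(u, u) \<in> anc_rel T"
  unfolding anc_rel_def by simp

lemma anc_antisym: "(u, v) \<in> anc_rel T \<Longrightarrow> (v, u) \<in> anc_rel T \<Longrightarrow> u = v"
  using tree_binary unfolding anc_rel_def binary_tree_def acyclic_def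
  by (metis rtranclD trancl_trans)

lemma lowest_common_ancestor:
  obtains w where "w \<in> {min u v..max u v}" "(u, w) \<in> anc_rel T" "(v, w) \<in> anc_rel T"
proof -
  have "\<exists>w. w \<in> {min u v..max u v} \<and> (u, w) \<in> anc_rel T \<and> (v, w) \<in> anc_rel T"
    using lca_cases[OF tree_binary, of u v]
  proof (elim disjE exE)
    assume "(u, v) \<in> anc_rel T"
    then show ?thesis using anc_refl[of v] by (intro exI[of _ v]) auto
  next
    assume "(v, u) \<in> anc_rel T"
    then show ?thesis using anc_refl[of u] by (intro exI[of _ u]) auto
  next
    fix w assume "u \<in> left_subtree T w \<and> v \<in> right_subtree T w"
    then show ?thesis unfolding left_subtree_iff right_subtree_iff by (intro exI[of _ w]) auto
  next
    fix w assume "v \<in> left_subtree T w \<and> u \<in> right_subtree T w"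
    then show ?thesis unfolding left_subtree_iff right_subtree_iff by (intro exI[of _ w]) auto
  qed
  then show thesis using that by blast
qed

text \<open>
  Some \<open>w\<close> between \<open>c\<close> and \<open>v\<close>, hence between \<open>u\<close> and \<open>v\<close>, is a common ancestor of \<open>c\<close> and \<open>v\<close>.
  If \<open>w\<close> were a proper ancestor of \<open>v\<close>, then \<open>u\<close> and \<open>v\<close> would lie in the same subtree of \<open>w\<close>, that
  is, on the same side of \<open>w\<close>.
\<close>

lemma anc_convex:
  assumes uv: "(u, v) \<in> anc_rel T" and c: "c \<in> {min u v..max u v}"
  shows "(c, v) \<in> anc_rel T"
proof -
  obtain w where w: "w \<in> {min c v..max c v}" "(c, w) \<in> anc_rel T" "(v, w) \<in> anc_rel T"
    by (rule lowest_common_ancestor)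
  have "w = v"
  proof (rule ccontr)
    assume "w \<noteq> v"
    then have "v \<in> left_subtree T w \<or> v \<in> right_subtree T w"
      using subtree_cases w(3) by metis
    then have "u \<in> left_subtree T w \<and> v \<in> left_subtree T w \<or>
        u \<in> right_subtree T w \<and> v \<in> right_subtree T w"
      using subtree_trans[OF uv] by blast
    then show False using w(1) c unfolding left_subtree_iff right_subtree_iff by auto
  qed
  then show ?thesis using w(2) by simp
qed

text \<open>
  The lowest common ancestor of \<open>u\<close> and \<open>v\<close> lies between them. It is \<open>v\<close> itself unless \<open>v\<close> is a
  proper descendant of some node there. Hence the right descendants determine the left
  descendants, and the other way round, both in an order-reversing manner.
\<close>

lemma anc_iff_no_ancestor_between:
  "(u, v) \<in> anc_rel T \<longleftrightarrow> (\<forall>c\<in>{min u v..max u v} - {v}. (v, c) \<notin> anc_rel T)"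
proof
  assume "(u, v) \<in> anc_rel T"
  then show "\<forall>c\<in>{min u v..max u v} - {v}. (v, c) \<notin> anc_rel T"
    using anc_convex anc_antisym by blast
next
  assume none: "\<forall>c\<in>{min u v..max u v} - {v}. (v, c) \<notin> anc_rel T"
  obtain w where "w \<in> {min u v..max u v}" "(u, w) \<in> anc_rel T" "(v, w) \<in> anc_rel T"
    by (rule lowest_common_ancestor)
  then show "(u, v) \<in> anc_rel T" using none by blast
qed

lemma linear_order_post_order: "linear_order (post_order T)"
  using is_post_order_post_order[OF tree_binary] unfolding is_post_order_def by blast

lemma anc_subset_post_order: "(u, v) \<in> anc_rel T \<Longrightarrow> (u, v) \<in> post_order T"
  using subtree_cases[of u v T] is_post_order_post_order[OF tree_binary]
    linear_orderD(1)[OF linear_order_post_order]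
  unfolding is_post_order_def by (cases "u = v") auto

text \<open>
  Let \<open>w\<close> be the lowest common ancestor of \<open>a < b\<close>. If \<open>w = b\<close> or \<open>a < w < b\<close>, then \<open>a\<close> is read
  first; only \<open>w = a\<close> remains.
\<close>

lemma post_order_inversion:
  assumes "a < b"
  shows "(b, a) \<in> post_order T \<longleftrightarrow> (b, a) \<in> anc_rel T"
proof
  assume ba: "(b, a) \<in> post_order T"
  obtain w where w: "w \<in> {min a b..max a b}" "(a, w) \<in> anc_rel T" "(b, w) \<in> anc_rel T"
    by (rule lowest_common_ancestor)
  have not_ab: "(a, b) \<notin> post_order T"
    using ba linear_orderD(3)[OF linear_order_post_order] assms by blast
  have "w \<noteq> b" using not_ab w(2) anc_subset_post_order by blast
  moreover have "\<not> (a < w \<and> w < b)"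
  proof
    assume "a < w \<and> w < b"
    then have "a \<in> left_subtree T w" "b \<in> right_subtree T w"
      using w unfolding left_subtree_iff right_subtree_iff by auto
    then show False
      using not_ab is_post_order_post_order[OF tree_binary] unfolding is_post_order_def by blast
  qed
  ultimately have "w = a" using w(1) assms by auto
  then show "(b, a) \<in> anc_rel T" using w(3) by simp
qed (rule anc_subset_post_order)

lemma anc_rel_eq_dominated: "anc_rel T = dominated (post_order T)"
proof -
  have "(u, v) \<in> anc_rel T \<longleftrightarrow> (u, v) \<in> dominated (post_order T)" for u v
  proof
    assume "(u, v) \<in> anc_rel T"
    then show "(u, v) \<in> dominated (post_order T)"
      using anc_convex anc_subset_post_order unfolding dominated_def by blast
  next
    assume dom: "(u, v) \<in> dominated (post_order T)"
    obtain w where w: "w \<in> {min u v..max u v}" "(u, w) \<in> anc_rel T" "(v, w) \<in> anc_rel T"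
      by (rule lowest_common_ancestor)
    have "(w, v) \<in> post_order T" using dom w(1) unfolding dominated_def by blast
    then have "w = v"
      using anc_subset_post_order[OF w(3)] linear_orderD(3)[OF linear_order_post_order] by blast
    then show "(u, v) \<in> anc_rel T" using w(2) by simp
  qed
  then show ?thesis by auto
qed

lemma avoids_312_post_order: "avoids_312 (post_order T)"
proof -
  have False if "a < b" "b < c" "(c, a) \<in> post_order T" "(a, b) \<in> post_order T" for a b c
  proof -
    have "(c, a) \<in> anc_rel T" using that post_order_inversion[of a c] by simp
    then have "(b, a) \<in> post_order T"
      using that anc_convex[of c a b] anc_subset_post_order by auto
    then show False using that linear_orderD(3)[OF linear_order_post_order] by blast
  qed
  then show ?thesis unfolding avoids_312_def by blast
qed

text \<open>
  The parent relation is the covering relation of \<^term>\<open>anc_rel T\<close>, so a tree with prescribed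
  in-order is determined by its ancestor relation.
\<close>

lemma parent_rel_iff_anc:
  "(c, v) \<in> parent_rel T \<longleftrightarrow> c \<noteq> v \<and> (c, v) \<in> anc_rel T \<and>
    (\<forall>u. (c, u) \<in> anc_rel T \<and> (u, v) \<in> anc_rel T \<longrightarrow> u = c \<or> u = v)"
proof
  assume cv: "(c, v) \<in> parent_rel T"
  have "c \<noteq> v" using cv tree_binary unfolding binary_tree_def acyclic_def by blast
  moreover have "u = c \<or> u = v" if cu: "(c, u) \<in> anc_rel T" and uv: "(u, v) \<in> anc_rel T" for u
  proof (rule ccontr)
    assume ne: "\<not> (u = c \<or> u = v)"
    then obtain z where z: "(c, z) \<in> parent_rel T" "(z, u) \<in> anc_rel T"
      using cu unfolding anc_rel_def by (auto elim: converse_rtranclE)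
    then have "z = v" using cv tree_binary unfolding binary_tree_def by blast
    then show False using z(2) uv anc_antisym ne by blast
  qed
  ultimately show "c \<noteq> v \<and> (c, v) \<in> anc_rel T \<and>
    (\<forall>u. (c, u) \<in> anc_rel T \<and> (u, v) \<in> anc_rel T \<longrightarrow> u = c \<or> u = v)"
    using cv unfolding anc_rel_def by blast
next
  assume cv: "c \<noteq> v \<and> (c, v) \<in> anc_rel T \<and>
    (\<forall>u. (c, u) \<in> anc_rel T \<and> (u, v) \<in> anc_rel T \<longrightarrow> u = c \<or> u = v)"
  then obtain z where z: "(c, z) \<in> parent_rel T" "(z, v) \<in> anc_rel T"
    unfolding anc_rel_def by (auto elim: converse_rtranclE)
  have "c \<noteq> z" using z(1) tree_binary unfolding binary_tree_def acyclic_def by blast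
  then have "z = v" using cv z unfolding anc_rel_def by blast
  then show "(c, v) \<in> parent_rel T" using z(1) by simp
qed

end

lemma in_ordered_tree_eqI:
  assumes "in_ordered_tree S" "in_ordered_tree T" "anc_rel S = anc_rel T"
  shows "S = T"
proof -
  have par: "parent_rel S = parent_rel T"
    using parent_rel_iff_anc[OF assms(1)] parent_rel_iff_anc[OF assms(2)] assms(3) by auto
  have "lchild S v = lchild T v" for v
    using in_ordered_tree_child(1)[OF assms(1), of v] in_ordered_tree_child(1)[OF assms(2), of v]
    unfolding par by (metis not_Some_eq)
  moreover have "rchild S v = rchild T v" for v
    using in_ordered_tree_child(2)[OF assms(1), of v] in_ordered_tree_child(2)[OF assms(2), of v]
    unfolding par by (metis not_Some_eq)
  ultimately have "lchild S = lchild T" "rchild S = rchild T" by auto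
  then show ?thesis by simp
qed

lemma anc_rel_translate:
  assumes par: "\<And>a b. (a, b) \<in> parent_rel T \<longleftrightarrow> (a + n, b + n) \<in> parent_rel T"
  shows "(u, v) \<in> anc_rel T \<longleftrightarrow> (u + n, v + n) \<in> anc_rel (T :: int bintree)"
proof
  assume "(u, v) \<in> anc_rel T"
  then have "(u, v) \<in> (parent_rel T)\<^sup>*" unfolding anc_rel_def .
  then have "(u + n, v + n) \<in> (parent_rel T)\<^sup>*"
  proof (induction rule: rtrancl_induct)
    case (step y z)
    then show ?case using par[of y z] by (meson rtrancl.rtrancl_into_rtrancl)
  qed simp
  then show "(u + n, v + n) \<in> anc_rel T" unfolding anc_rel_def .
next
  assume "(u + n, v + n) \<in> anc_rel T"
  then have "(u + n, v + n) \<in> (parent_rel T)\<^sup>*" unfolding anc_rel_def .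
  then have "(u + n - n, v + n - n) \<in> (parent_rel T)\<^sup>*"
  proof (induction rule: rtrancl_induct)
    case (step y z)
    then show ?case using par[of "y - n" "z - n"] by (auto intro: rtrancl.rtrancl_into_rtrancl)
  qed simp
  then show "(u, v) \<in> anc_rel T" unfolding anc_rel_def by simp
qed

lemma post_order_in_CTam312:
  assumes "T \<in> CTamTree n"
  shows "post_order T \<in> CTam312 n"
proof -
  have T: "in_ordered_tree T" using assms CTamTree_iff by blast
  note lin = linear_order_post_order[OF T]
  have anc: "(u, v) \<in> anc_rel T \<longleftrightarrow> (u + n, v + n) \<in> anc_rel T" for u v
    using assms CTamTree_iff by (intro anc_rel_translate) blast
  have lt: "(b, a) \<in> post_order T \<longleftrightarrow> (b + n, a + n) \<in> post_order T" if "a < b" for a b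
    using post_order_inversion[OF T] that anc by simp
  have flip: "(a, b) \<in> post_order T \<longleftrightarrow> (b, a) \<notin> post_order T" if "a \<noteq> b" for a b
    using linear_orderD(3,4)[OF lin] that by blast
  have "(a, b) \<in> post_order T \<longleftrightarrow> (a + n, b + n) \<in> post_order T" for a b
  proof (cases a b rule: linorder_cases)
    case less
    then show ?thesis using flip[of a b] flip[of "a + n" "b + n"] lt[of a b] by simp
  next
    case equal
    then show ?thesis using linear_orderD(1)[OF lin] by simp
  qed (rule lt)
  then show ?thesis
    using lin avoids_312_post_order[OF T] unfolding CTam312_def CDyer_def by blast
qed


section \<open>Mirror images and self-duality\<close>

definition mirror_tree :: "int bintree \<Rightarrow> int bintree" where
  "mirror_tree T = \<lparr>lchild = \<lambda>v. map_option uminus (rchild T (- v)),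
    rchild = \<lambda>v. map_option uminus (lchild T (- v))\<rparr>"

lemma mirror_mirror [simp]: "mirror_tree (mirror_tree T) = T"
  unfolding mirror_tree_def by (simp add: option.map_comp comp_def option.map_ident)

lemma parent_rel_mirror: "parent_rel (mirror_tree T) = neg_rel (parent_rel T)"
  unfolding parent_rel_def mirror_tree_def neg_rel_def by force

lemma neg_rel_rtrancl: "neg_rel (R\<^sup>*) = (neg_rel R)\<^sup>*"
proof -
  have mono: "(- a, - b) \<in> (neg_rel S)\<^sup>*" if "(a, b) \<in> S\<^sup>*" for S a b
    using that
  proof (induction rule: rtrancl_induct)
    case (step y z)
    then have "(- y, - z) \<in> neg_rel S" unfolding neg_rel_def by simp
    then show ?case using step by (meson rtrancl.rtrancl_into_rtrancl)
  qed simp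
  have "(a, b) \<in> neg_rel (R\<^sup>*) \<longleftrightarrow> (a, b) \<in> (neg_rel R)\<^sup>*" for a b
    using mono[of "- a" "- b" R] mono[of a b "neg_rel R"] by (auto simp: neg_rel_def)
  then show ?thesis by auto
qed

lemma anc_rel_mirror: "anc_rel (mirror_tree T) = neg_rel (anc_rel T)"
  unfolding anc_rel_def parent_rel_mirror neg_rel_rtrancl ..

lemma subtree_mirror:
  "u \<in> left_subtree (mirror_tree T) v \<longleftrightarrow> - u \<in> right_subtree T (- v)"
  "u \<in> right_subtree (mirror_tree T) v \<longleftrightarrow> - u \<in> left_subtree T (- v)"
  unfolding left_subtree_def right_subtree_def anc_rel_mirror
  by (auto simp: mirror_tree_def neg_rel_def)

lemma mirror_in_CTamTree:
  assumes "T \<in> CTamTree n" shows "mirror_tree T \<in> CTamTree n"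
proof -
  have T: "in_ordered_tree T"
    and par: "\<And>a b. (a, b) \<in> parent_rel T \<longleftrightarrow> (a + n, b + n) \<in> parent_rel T"
    using assms CTamTree_iff by blast+
  have B: "binary_tree T" using T unfolding in_ordered_tree_def by blast
  have sides: "left_subtree (mirror_tree T) v \<subseteq> {..<v}"
    "right_subtree (mirror_tree T) v \<subseteq> {v<..}" for v
    using T unfolding in_ordered_tree_def by (force simp: subtree_mirror)+
  have acyc: "acyclic (parent_rel (mirror_tree T))"
    unfolding acyclic_def
  proof (intro allI notI)
    fix x assume "(x, x) \<in> (parent_rel (mirror_tree T))\<^sup>+"
    then obtain y where y: "(x, y) \<in> anc_rel (mirror_tree T)" "(y, x) \<in> parent_rel (mirror_tree T)"
      unfolding anc_rel_def by (meson tranclD2)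
    then have "(- x, - y) \<in> (parent_rel T)\<^sup>*" "(- y, - x) \<in> parent_rel T"
      unfolding anc_rel_mirror parent_rel_mirror by (auto simp: neg_rel_def anc_rel_def)
    then have "(- x, - x) \<in> (parent_rel T)\<^sup>+" by (rule rtrancl_into_trancl1)
    then show False using B unfolding binary_tree_def acyclic_def by blast
  qed
  have common: "\<exists>w. (u, w) \<in> anc_rel (mirror_tree T) \<and> (v, w) \<in> anc_rel (mirror_tree T)" for u v
  proof -
    obtain w where "(- u, w) \<in> anc_rel T" "(- v, w) \<in> anc_rel T"
      using B unfolding binary_tree_def by blast
    then show ?thesis unfolding anc_rel_mirror neg_rel_def by (auto intro: exI[of _ "- w"])
  qed
  have single: "v = w" if "(u, v) \<in> parent_rel (mirror_tree T)" "(u, w) \<in> parent_rel (mirror_tree T)"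
    for u v w
    using that B unfolding parent_rel_mirror neg_rel_def binary_tree_def
    by (metis (no_types, lifting) case_prodD mem_Collect_eq neg_equal_iff_equal)
  have one_side: "\<not> (lchild (mirror_tree T) v = Some u \<and> rchild (mirror_tree T) v = Some u)" for u v
    using B unfolding mirror_tree_def binary_tree_def by auto
  have "in_ordered_tree (mirror_tree T)"
    unfolding in_ordered_tree_def binary_tree_def using acyc common single one_side sides by blast
  moreover have "(a, b) \<in> parent_rel (mirror_tree T) \<longleftrightarrow>
      (a + n, b + n) \<in> parent_rel (mirror_tree T)" for a b
    using par[of "- a - n" "- b - n"] unfolding parent_rel_mirror neg_rel_def by simp
  ultimately show ?thesis using CTamTree_iff by blast
qed

lemma ctam_tree_order_iff:
  assumes "S \<in> CTamTree n" "T \<in> CTamTree n"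
  shows "(S, T) \<in> ctam_tree_order n \<longleftrightarrow>
    (\<forall>a b. a < b \<longrightarrow> (b, a) \<in> anc_rel S \<longrightarrow> (b, a) \<in> anc_rel T)"
proof -
  have "in_ordered_tree S" "in_ordered_tree T" using assms CTamTree_iff by blast+
  moreover have "post_order S \<in> CDyer n" "post_order T \<in> CDyer n"
    using assms post_order_in_CTam312 unfolding CTam312_def by blast+
  ultimately show ?thesis
    using assms unfolding ctam_tree_order_def by (simp add: dyer_order_iff post_order_inversion)
qed

text \<open>
  Right descendants of the mirror image are left descendants of the original, and a tree with
  more right descendants has fewer left descendants.
\<close>

lemma self_dual_CTamTree: "self_dual (CTamTree n) (ctam_tree_order n)"
proof -
  have "bij_betw mirror_tree (CTamTree n) (CTamTree n)"
    by (rule bij_betw_byWitness[where f' = mirror_tree]) (auto intro: mirror_in_CTamTree)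
  moreover have "(S, T) \<in> ctam_tree_order n \<longleftrightarrow>
      (mirror_tree S, mirror_tree T) \<in> (ctam_tree_order n)\<inverse>"
    if S: "S \<in> CTamTree n" and T: "T \<in> CTamTree n" for S T
  proof -
    have I: "in_ordered_tree S" "in_ordered_tree T" using S T CTamTree_iff by blast+
    have "(mirror_tree T, mirror_tree S) \<in> ctam_tree_order n \<longleftrightarrow>
        (\<forall>a b. a < b \<longrightarrow> (- b, - a) \<in> anc_rel T \<longrightarrow> (- b, - a) \<in> anc_rel S)"
      using S T by (simp add: ctam_tree_order_iff mirror_in_CTamTree anc_rel_mirror neg_rel_def)
    also have "\<dots> \<longleftrightarrow> (\<forall>a b. a < b \<longrightarrow> (a, b) \<in> anc_rel T \<longrightarrow> (a, b) \<in> anc_rel S)"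
      by (rule all_less_neg[symmetric])
    also have "\<dots> \<longleftrightarrow> (\<forall>a b. a < b \<longrightarrow> (b, a) \<in> anc_rel S \<longrightarrow> (b, a) \<in> anc_rel T)"
    proof (intro iffI allI impI)
      fix a b :: int
      assume sub: "\<forall>a b. a < b \<longrightarrow> (a, b) \<in> anc_rel T \<longrightarrow> (a, b) \<in> anc_rel S"
        and ab: "a < b" and S: "(b, a) \<in> anc_rel S"
      have "(a, c) \<notin> anc_rel T" if c: "c \<in> {min b a..max b a} - {a}" for c
      proof -
        have "a < c" using c ab by auto
        then show ?thesis using sub c S anc_iff_no_ancestor_between[OF I(1), of b a] by blast
      qed
      then show "(b, a) \<in> anc_rel T" using anc_iff_no_ancestor_between[OF I(2), of b a] by blast
    next
      fix a b :: int
      assume sub: "\<forall>a b. a < b \<longrightarrow> (b, a) \<in> anc_rel S \<longrightarrow> (b, a) \<in> anc_rel T"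
        and ab: "a < b" and T: "(a, b) \<in> anc_rel T"
      have "(b, c) \<notin> anc_rel S" if c: "c \<in> {min a b..max a b} - {b}" for c
      proof -
        have "c < b" using c ab by auto
        then show ?thesis using sub c T anc_iff_no_ancestor_between[OF I(2), of a b] by blast
      qed
      then show "(a, b) \<in> anc_rel S" using anc_iff_no_ancestor_between[OF I(1), of a b] by blast
    qed
    also have "\<dots> \<longleftrightarrow> (S, T) \<in> ctam_tree_order n" using S T by (simp add: ctam_tree_order_iff)
    finally show ?thesis by simp
  qed
  ultimately show ?thesis unfolding self_dual_def poset_isomorphic_def by blast
qed


section \<open>The tree of a translation-invariant total order\<close>

text \<open>
  The Cartesian tree of \<open>r\<close> with the last element on top: a child of \<open>v\<close> comes last among all
  integers dominated by \<open>v\<close> on its side of \<open>v\<close>.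
\<close>

definition tree_child :: "int rel \<Rightarrow> int \<Rightarrow> int \<Rightarrow> bool" where
  "tree_child r v c \<longleftrightarrow> c \<noteq> v \<and> (c, v) \<in> dominated r \<and>
    (\<forall>u. u \<noteq> v \<and> (u, v) \<in> dominated r \<and> (u < v \<longleftrightarrow> c < v) \<longrightarrow> (u, c) \<in> r)"

definition tree_of_order :: "int rel \<Rightarrow> int bintree" where
  "tree_of_order r =
    \<lparr>lchild = \<lambda>v. if \<exists>c<v. tree_child r v c then Some (THE c. c < v \<and> tree_child r v c) else None,
     rchild = \<lambda>v. if \<exists>c>v. tree_child r v c then Some (THE c. c > v \<and> tree_child r v c) else None\<rparr>"

context
  fixes r :: "int rel" and n :: int
  assumes r: "r \<in> CDyer n" and n: "n > 0"
begin

lemma r_linear: "linear_order r"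
  using r unfolding CDyer_def by blast

lemmas r_refl = linear_orderD(1)[OF r_linear]
  and r_trans = linear_orderD(2)[OF r_linear]
  and r_antisym = linear_orderD(3)[OF r_linear]
  and r_total = linear_orderD(4)[OF r_linear]

lemma dominated_refl: "(u, u) \<in> dominated r"
  unfolding dominated_def using r_refl by auto

lemma dominatedD: "(u, v) \<in> dominated r \<Longrightarrow> (u, v) \<in> r"
  unfolding dominated_def by force

lemma dominated_convex:
  assumes "(u, v) \<in> dominated r" "c \<in> {min u v..max u v}"
  shows "(c, v) \<in> dominated r"
proof -
  have "{min c v..max c v} \<subseteq> {min u v..max u v}" using assms(2) by auto
  then show ?thesis using assms(1) unfolding dominated_def by blast
qed

lemma dominated_trans:
  assumes "(u, v) \<in> dominated r" "(v, w) \<in> dominated r"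
  shows "(u, w) \<in> dominated r"
proof -
  have "(c, w) \<in> r" if c: "c \<in> {min u w..max u w}" for c
  proof (cases "c \<in> {min v w..max v w}")
    case True then show ?thesis using assms(2) unfolding dominated_def by blast
  next
    case False
    then have "c \<in> {min u v..max u v}" using c by auto
    then show ?thesis using assms r_trans dominatedD unfolding dominated_def by blast
  qed
  then show ?thesis unfolding dominated_def by blast
qed

lemma dominated_antisym: "(u, v) \<in> dominated r \<Longrightarrow> (v, u) \<in> dominated r \<Longrightarrow> u = v"
  using dominatedD r_antisym by blast

lemma dominators_comparable:
  assumes "(c, v) \<in> dominated r" "(c, w) \<in> dominated r" "(v, w) \<in> r"
  shows "(v, w) \<in> dominated r"
proof -
  have "(x, w) \<in> r" if x: "x \<in> {min v w..max v w}" for x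
  proof (cases "x \<in> {min c w..max c w}")
    case True then show ?thesis using assms(2) unfolding dominated_def by blast
  next
    case False
    then have "x \<in> {min c v..max c v}" using x by auto
    then show ?thesis using assms(1,3) r_trans unfolding dominated_def by blast
  qed
  then show ?thesis unfolding dominated_def by blast
qed

lemma dominated_translate:
  "(u + k * n, v + k * n) \<in> dominated r \<longleftrightarrow> (u, v) \<in> dominated r"
proof -
  have "(\<forall>c\<in>{min (u + k * n) (v + k * n)..max (u + k * n) (v + k * n)}. (c, v + k * n) \<in> r) \<longleftrightarrow>
    (\<forall>c\<in>{min u v..max u v}. (c + k * n, v + k * n) \<in> r)"
  proof (intro iffI ballI)
    fix c assume dom: "\<forall>c\<in>{min u v..max u v}. (c + k * n, v + k * n) \<in> r"
      and "c \<in> {min (u + k * n) (v + k * n)..max (u + k * n) (v + k * n)}"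
    then have "c - k * n \<in> {min u v..max u v}" by auto
    then show "(c, v + k * n) \<in> r" using dom by fastforce
  next
    fix c assume dom: "\<forall>c\<in>{min (u + k * n) (v + k * n)..max (u + k * n) (v + k * n)}. (c, v + k * n) \<in> r"
      and "c \<in> {min u v..max u v}"
    then have "c + k * n \<in> {min (u + k * n) (v + k * n)..max (u + k * n) (v + k * n)}" by auto
    then show "(c + k * n, v + k * n) \<in> r" using dom by blast
  qed
  then show ?thesis unfolding dominated_def by (simp add: CDyer_translate[OF r])
qed

lemma finite_has_last:
  assumes "finite S" "S \<noteq> {}"
  shows "\<exists>m\<in>S. \<forall>u\<in>S. (u, m) \<in> r"
  using assms
proof (induction rule: finite_ne_induct)
  case (singleton x) then show ?case using r_refl by simp
next
  case (insert x F)
  then show ?case using r_total r_refl r_trans by (metis insert_iff)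
qed

text \<open>
  Even if \<open>v\<close> dominates infinitely many integers on one side, there is a last one: the last one
  within distance \<open>n\<close> of \<open>v\<close> works. Take \<open>u\<close> farther away, say on the left. Either \<open>u\<close> comes
  before \<open>u + n\<close>, which is closer to \<open>v\<close>; or \<open>u + n\<close> comes before \<open>u\<close>, hence before \<open>v\<close>, and by
  translation \<open>u\<close> comes before \<open>v - n\<close>.
\<close>

lemma ex_tree_child:
  assumes u: "(u, v) \<in> dominated r" "u \<noteq> v"
  obtains c where "tree_child r v c" "(u, c) \<in> dominated r" "c < v \<longleftrightarrow> u < v" "\<bar>c - v\<bar> \<le> n"
proof -
  define side where "side = {w. (w, v) \<in> dominated r \<and> w \<noteq> v \<and> (w < v \<longleftrightarrow> u < v)}"
  define near where "near = side \<inter> {v - n..v + n}"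
  (* adding e moves u, and any element of side, one period towards v *)
  define e where "e = (if u < v then n else - n)"
  have side_convex: "w \<in> side" if "x \<in> side" "w \<in> {min x v..max x v}" "w \<noteq> v" for w x
    using that dominated_convex[of x v w] unfolding side_def by auto
  have "(if u < v then v - 1 else v + 1) \<in> near"
    using side_convex[of u "if u < v then v - 1 else v + 1"] u n unfolding near_def side_def by auto
  then have "near \<noteq> {}" by blast
  moreover have "finite near" unfolding near_def by simp
  ultimately obtain c where c: "c \<in> near" "\<forall>w\<in>near. (w, c) \<in> r"
    using finite_has_last by blast
  have last: "(w, c) \<in> r" if "w \<in> side" for w
    using that
  proof (induction "nat \<bar>w - v\<bar>" arbitrary: w rule: less_induct)
    case less
    show ?case
    proof (cases "\<bar>w - v\<bar> \<le> n")
      case True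
      then have "w \<in> near" using less.prems unfolding near_def by auto
      then show ?thesis using c(2) by blast
    next
      case False
      have closer: "w + e \<in> side" "v - e \<in> side" "nat \<bar>w + e - v\<bar> < nat \<bar>w - v\<bar>"
        using False less.prems n side_convex[OF less.prems, of "w + e"]
          side_convex[OF less.prems, of "v - e"]
        unfolding e_def side_def by (auto split: if_splits)
      from r_total show ?thesis
      proof
        assume "(w, w + e) \<in> r"
        then show ?thesis using less.hyps closer r_trans by blast
      next
        assume "(w + e, w) \<in> r"
        then have "(w + e, v) \<in> r"
          using less.prems dominatedD r_trans unfolding side_def by blast
        then have "(w, v - e) \<in> r"
          using CDyer_translate[OF r, of w 1 "v - n"] CDyer_translate[OF r, of w "- 1" "v + n"]
          unfolding e_def by (simp split: if_splits)
        moreover have "v - e \<in> near" using closer(2) n unfolding near_def e_def by auto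
        ultimately show ?thesis using c(2) r_trans by blast
      qed
    qed
  qed
  have cs: "c \<in> side" "\<bar>c - v\<bar> \<le> n" using c(1) unfolding near_def by auto
  have "tree_child r v c" using cs(1) last unfolding tree_child_def side_def by blast
  moreover have "(u, c) \<in> dominated r"
  proof -
    have "w \<in> side" if w: "w \<in> {min u c..max u c}" for w
    proof -
      have "w \<noteq> v" "w \<in> {min u v..max u v} \<or> w \<in> {min c v..max c v}"
        using w cs(1) u(2) unfolding side_def by auto
      moreover have "u \<in> side" using u unfolding side_def by blast
      ultimately show ?thesis using side_convex cs(1) by blast
    qed
    then show ?thesis using last unfolding dominated_def by blast
  qed
  ultimately show thesis using that cs unfolding side_def by blast
qed

lemma tree_child_unique:
  "tree_child r v c \<Longrightarrow> tree_child r v d \<Longrightarrow> (c < v \<longleftrightarrow> d < v) \<Longrightarrow> c = d"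
  unfolding tree_child_def using r_antisym by blast

lemma tree_child_near:
  assumes "tree_child r v c" shows "\<bar>c - v\<bar> \<le> n"
proof -
  have "(c, v) \<in> dominated r" "c \<noteq> v" using assms unfolding tree_child_def by blast+
  then obtain d where "tree_child r v d" "d < v \<longleftrightarrow> c < v" "\<bar>d - v\<bar> \<le> n"
    by (rule ex_tree_child)
  then show ?thesis using tree_child_unique[OF assms, of d] by blast
qed

lemma tree_child_translate:
  "tree_child r (v + k * n) (c + k * n) \<longleftrightarrow> tree_child r v c"
proof -
  have imp: "tree_child r (v + k * n) (c + k * n)" if child: "tree_child r v c" for v c k
    unfolding tree_child_def
  proof (intro conjI allI impI)
    show "c + k * n \<noteq> v + k * n" using child unfolding tree_child_def by simp
    show "(c + k * n, v + k * n) \<in> dominated r"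
      using child dominated_translate unfolding tree_child_def by blast
    fix u assume u: "u \<noteq> v + k * n \<and> (u, v + k * n) \<in> dominated r \<and>
      (u < v + k * n \<longleftrightarrow> c + k * n < v + k * n)"
    then have "(u - k * n, v) \<in> dominated r"
      using dominated_translate[of "u - k * n" k v] by simp
    then have "(u - k * n, c) \<in> r"
      using child u unfolding tree_child_def by (smt (verit))
    then show "(u, c + k * n) \<in> r" using CDyer_translate[OF r, of "u - k * n" k c] by simp
  qed
  show ?thesis using imp[of v c k] imp[of "v + k * n" "c + k * n" "- k"] by auto
qed

lemma child_tree_of_order:
  "lchild (tree_of_order r) v = Some c \<longleftrightarrow> c < v \<and> tree_child r v c"
  "rchild (tree_of_order r) v = Some c \<longleftrightarrow> v < c \<and> tree_child r v c"
proof -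
  have "(THE c. c < v \<and> tree_child r v c) = d" if "d < v" "tree_child r v d" for d
    using that tree_child_unique by (intro the_equality) auto
  then show "lchild (tree_of_order r) v = Some c \<longleftrightarrow> c < v \<and> tree_child r v c"
    unfolding tree_of_order_def by auto
  have "(THE c. v < c \<and> tree_child r v c) = d" if "v < d" "tree_child r v d" for d
    using that tree_child_unique by (intro the_equality) auto
  then show "rchild (tree_of_order r) v = Some c \<longleftrightarrow> v < c \<and> tree_child r v c"
    unfolding tree_of_order_def by auto
qed

lemma parent_rel_tree_of_order: "(c, v) \<in> parent_rel (tree_of_order r) \<longleftrightarrow> tree_child r v c"
  unfolding parent_rel_def using child_tree_of_order by (auto simp: tree_child_def)

text \<open>
  Descending from \<open>v\<close> towards a dominated node \<open>u\<close> must reach \<open>u\<close> after finitely many steps. The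
  next node is closer to \<open>u\<close> than the present one or, if \<open>u\<close> is passed over, within distance
  \<open>n\<close> of \<open>u\<close>. So the path stays in a bounded region, and it never returns to a node.
\<close>

lemma dominated_subset_anc:
  "(u, v) \<in> dominated r \<Longrightarrow> (u, v) \<in> anc_rel (tree_of_order r)"
proof -
  define S where "S v = {w. (u, w) \<in> dominated r \<and> (w, v) \<in> dominated r \<and>
    \<bar>w - u\<bar> \<le> max (abs (v - u)) n}" for v
  have fin: "finite (S v)" for v
  proof (rule finite_subset)
    show "S v \<subseteq> {u - max (abs (v - u)) n..u + max (abs (v - u)) n}" unfolding S_def by auto
  qed simp
  show "(u, v) \<in> dominated r \<Longrightarrow> (u, v) \<in> anc_rel (tree_of_order r)"
  proof (induction "card (S v)" arbitrary: v rule: less_induct)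
    case less
    show ?case
    proof (cases "u = v")
      case True then show ?thesis unfolding anc_rel_def by simp
    next
      case False
      then obtain c where c: "tree_child r v c" "(u, c) \<in> dominated r"
          "c < v \<longleftrightarrow> u < v" "\<bar>c - v\<bar> \<le> n"
        by (rule ex_tree_child[OF less.prems])
      have cv: "(c, v) \<in> dominated r" "c \<noteq> v" using c(1) unfolding tree_child_def by auto
      have "max (abs (c - u)) n \<le> max (abs (v - u)) n" using c(3,4) False cv(2) by linarith
      then have "S c \<subseteq> S v" unfolding S_def using dominated_trans[OF _ cv(1)] by auto
      moreover have "v \<in> S v" unfolding S_def using less.prems dominated_refl by auto
      moreover have "v \<notin> S c" unfolding S_def using dominated_antisym cv by blast
      ultimately have "card (S c) < card (S v)" by (intro psubset_card_mono fin) blast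
      then have "(u, c) \<in> anc_rel (tree_of_order r)" using less.hyps c(2) by blast
      moreover have "(c, v) \<in> parent_rel (tree_of_order r)"
        using c(1) parent_rel_tree_of_order by blast
      ultimately show ?thesis unfolding anc_rel_def by (rule rtrancl.rtrancl_into_rtrancl)
    qed
  qed
qed

lemma anc_rel_tree_of_order: "anc_rel (tree_of_order r) = dominated r"
proof -
  have "(u, v) \<in> dominated r" if "(u, v) \<in> (parent_rel (tree_of_order r))\<^sup>*" for u v
    using that
  proof (induction rule: rtrancl_induct)
    case base show ?case by (rule dominated_refl)
  next
    case (step y z)
    then have "(y, z) \<in> dominated r"
      using parent_rel_tree_of_order unfolding tree_child_def by blast
    then show ?case using step.IH dominated_trans by blast
  qed
  then show ?thesis using dominated_subset_anc unfolding anc_rel_def by auto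
qed

text \<open>
  Of two nodes that dominate \<open>c\<close>, the earlier one, \<open>v\<close>, is dominated by the later one, \<open>w\<close>, and
  lies on the same side of \<open>w\<close> as \<open>c\<close>. So if \<open>c\<close> is a child of \<open>w\<close>, then \<open>v\<close> does not come after
  \<open>c\<close>, and \<open>c\<close> is not a child of \<open>v\<close>.
\<close>

lemma tree_child_single_parent:
  assumes "tree_child r v c" "tree_child r w c"
  shows "v = w"
proof -
  have *: "v = w" if child: "tree_child r v c" "tree_child r w c" and vw: "(v, w) \<in> r" for v w
  proof (rule ccontr)
    assume ne: "v \<noteq> w"
    have cv: "(c, v) \<in> dominated r" "c \<noteq> v" and cw: "(c, w) \<in> dominated r" "c \<noteq> w"
      using child unfolding tree_child_def by auto
    have dom: "(v, w) \<in> dominated r" using dominators_comparable cv(1) cw(1) vw by blast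
    have "w \<notin> {min c v..max c v}"
      using cv(1) ne vw r_antisym unfolding dominated_def by blast
    then have "v < w \<longleftrightarrow> c < w" by auto
    then have "(v, c) \<in> r" using child(2) dom ne unfolding tree_child_def by blast
    then show False using cv dominatedD r_antisym by blast
  qed
  show ?thesis using *[OF assms] *[OF assms(2,1)] r_total[of v w] by blast
qed

lemma tree_of_order_in_CTamTree: "tree_of_order r \<in> CTamTree n"
proof -
  let ?T = "tree_of_order r"
  have "single_valued (parent_rel ?T)"
    unfolding single_valued_def parent_rel_tree_of_order using tree_child_single_parent by blast
  moreover have "\<not> (lchild ?T v = Some u \<and> rchild ?T v = Some u)" for u v
    unfolding child_tree_of_order by auto
  moreover have "acyclic (parent_rel ?T)"
    unfolding acyclic_def
  proof (intro allI notI)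
    fix x assume "(x, x) \<in> (parent_rel ?T)\<^sup>+"
    then obtain y where y: "(x, y) \<in> anc_rel ?T" "(y, x) \<in> parent_rel ?T"
      unfolding anc_rel_def by (meson tranclD2)
    then show False
      unfolding anc_rel_tree_of_order parent_rel_tree_of_order tree_child_def
      using dominated_antisym by blast
  qed
  moreover have "\<exists>w. (u, w) \<in> anc_rel ?T \<and> (v, w) \<in> anc_rel ?T" for u v
  proof -
    obtain w where w: "w \<in> {min u v..max u v}" "\<forall>x\<in>{min u v..max u v}. (x, w) \<in> r"
      using finite_has_last[of "{min u v..max u v}"] by fastforce
    moreover have "{min u w..max u w} \<subseteq> {min u v..max u v}" "{min v w..max v w} \<subseteq> {min u v..max u v}"
      using w(1) by auto
    ultimately have "(u, w) \<in> dominated r" "(v, w) \<in> dominated r"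
      unfolding dominated_def by blast+
    then show ?thesis unfolding anc_rel_tree_of_order by blast
  qed
  ultimately have B: "binary_tree ?T" unfolding binary_tree_def single_valued_def by blast
  have "u < v" if u: "u \<in> left_subtree ?T v" for u v
  proof (rule ccontr)
    assume "\<not> u < v"
    obtain c where c: "c < v" "tree_child r v c" "(u, c) \<in> dominated r"
      using u unfolding left_subtree_def child_tree_of_order anc_rel_tree_of_order by blast
    then have "(v, c) \<in> dominated r" using \<open>\<not> u < v\<close> dominated_convex[of u c v] by simp
    then show False using c dominated_antisym unfolding tree_child_def by blast
  qed
  moreover have "v < u" if u: "u \<in> right_subtree ?T v" for u v
  proof (rule ccontr)
    assume "\<not> v < u"
    obtain c where c: "v < c" "tree_child r v c" "(u, c) \<in> dominated r"
      using u unfolding right_subtree_def child_tree_of_order anc_rel_tree_of_order by blast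
    then have "(v, c) \<in> dominated r" using \<open>\<not> v < u\<close> dominated_convex[of u c v] by simp
    then show False using c dominated_antisym unfolding tree_child_def by blast
  qed
  ultimately have "in_ordered_tree ?T" using B unfolding in_ordered_tree_def by blast
  moreover have "(a, b) \<in> parent_rel ?T \<longleftrightarrow> (a + n, b + n) \<in> parent_rel ?T" for a b
    using tree_child_translate[of b 1 a] unfolding parent_rel_tree_of_order by simp
  ultimately show ?thesis using CTamTree_iff by blast
qed

text \<open>
  Let \<open>u\<close> and \<open>w\<close> belong to the left and the right subtree of \<open>v\<close>. Then \<open>u < v < w\<close> and \<open>v\<close> comes
  after both, so \<open>w\<close> before \<open>u\<close> would give the pattern 312 on \<open>w, u, v\<close>. Hence \<open>r\<close> reads the left
  subtree before the right one.
\<close>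

lemma post_order_tree_of_order:
  assumes "avoids_312 r"
  shows "post_order (tree_of_order r) = r"
proof -
  let ?T = "tree_of_order r"
  have T: "in_ordered_tree ?T" using tree_of_order_in_CTamTree CTamTree_iff by blast
  have "(u, w) \<in> r" if "u \<in> left_subtree ?T v" "w \<in> right_subtree ?T v" for u v w
  proof -
    have "u < v" "(u, v) \<in> r" "v < w"
      using that dominatedD unfolding left_subtree_iff[OF T] right_subtree_iff[OF T]
        anc_rel_tree_of_order by auto
    then show ?thesis using assms r_total unfolding avoids_312_def by blast
  qed
  then have "is_post_order ?T r"
    using r_linear dominatedD unfolding is_post_order_def
    by (simp add: left_subtree_iff[OF T] right_subtree_iff[OF T] anc_rel_tree_of_order)
  moreover have "binary_tree ?T" using T unfolding in_ordered_tree_def by blast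
  ultimately show ?thesis using post_order_unique is_post_order_post_order by blast
qed

end


section \<open>The isomorphism, and finiteness\<close>

lemma CTamTree_isomorphic_CTam312:
  assumes "n > 0"
  shows "poset_isomorphic (CTamTree n) (ctam_tree_order n) (CTam312 n) (ctam312_order n)"
proof -
  have "bij_betw post_order (CTamTree n) (CTam312 n)"
  proof (rule bij_betw_byWitness[where f' = tree_of_order])
    show "\<forall>T\<in>CTamTree n. tree_of_order (post_order T) = T"
    proof
      fix T assume T: "T \<in> CTamTree n"
      then have P: "post_order T \<in> CDyer n"
        using post_order_in_CTam312 unfolding CTam312_def by blast
      have I: "in_ordered_tree T" "in_ordered_tree (tree_of_order (post_order T))"
        using T tree_of_order_in_CTamTree[OF P assms] CTamTree_iff by blast+
      show "tree_of_order (post_order T) = T"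
        using in_ordered_tree_eqI[OF I] anc_rel_eq_dominated[OF I(1)]
          anc_rel_tree_of_order[OF P assms] by simp
    qed
    show "\<forall>r\<in>CTam312 n. post_order (tree_of_order r) = r"
      using post_order_tree_of_order assms unfolding CTam312_def by blast
    show "post_order ` CTamTree n \<subseteq> CTam312 n" using post_order_in_CTam312 by blast
    show "tree_of_order ` CTam312 n \<subseteq> CTamTree n"
      using tree_of_order_in_CTamTree assms unfolding CTam312_def by blast
  qed
  moreover have "(S, T) \<in> ctam_tree_order n \<longleftrightarrow> (post_order S, post_order T) \<in> ctam312_order n"
    if "S \<in> CTamTree n" "T \<in> CTamTree n" for S T
    using that post_order_in_CTam312 unfolding ctam_tree_order_def ctam312_order_def by blast
  ultimately show ?thesis unfolding poset_isomorphic_def by blast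
qed

text \<open>
  The children of the nodes \<open>0, \<dots>, n - 1\<close> determine the tree by translation. There are finitely
  many choices for them, because a child has distance at most \<open>n\<close> from its parent.
\<close>

lemma finite_CTam312:
  assumes n: "n > 0" shows "finite (CTam312 n)"
proof -
  define code where "code r = {(v, c). v \<in> {0..<n} \<and> tree_child r v c}" for r
  have "code ` CTam312 n \<subseteq> Pow ({0..<n} \<times> {- n..2 * n})"
  proof -
    have "code r \<subseteq> {0..<n} \<times> {- n..2 * n}" if "r \<in> CTam312 n" for r
    proof -
      have "r \<in> CDyer n" using that unfolding CTam312_def by blast
      then have "c \<in> {- n..2 * n}" if "tree_child r v c" "v \<in> {0..<n}" for v c
        using tree_child_near[OF _ n that(1)] that(2) by (simp add: abs_le_iff)
      then show ?thesis unfolding code_def by blast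
    qed
    then show ?thesis by blast
  qed
  then have "finite (code ` CTam312 n)" by (rule finite_subset) simp
  moreover have "inj_on code (CTam312 n)"
  proof (rule inj_onI)
    fix r s assume rs: "r \<in> CTam312 n" "s \<in> CTam312 n" and eq: "code r = code s"
    have C: "r \<in> CDyer n" "s \<in> CDyer n" and av: "avoids_312 r" "avoids_312 s"
      using rs unfolding CTam312_def by auto
    have "tree_child r v c \<longleftrightarrow> tree_child s v c" for v c
    proof -
      obtain k where v: "v + k * n \<in> {0..<n}"
      proof
        show "v + - (v div n) * n \<in> {0..<n}"
          using n by (simp add: minus_div_mult_eq_mod)
      qed
      have "tree_child q v c \<longleftrightarrow> (v + k * n, c + k * n) \<in> code q" if "q \<in> CDyer n" for q
      proof -
        have "(v + k * n, c + k * n) \<in> code q \<longleftrightarrow> tree_child q (v + k * n) (c + k * n)"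
          using v unfolding code_def by simp
        then show ?thesis by (simp only: tree_child_translate[OF that n])
      qed
      from this[OF C(1)] this[OF C(2)] show ?thesis by (simp only: eq)
    qed
    then have "parent_rel (tree_of_order r) = parent_rel (tree_of_order s)"
      using parent_rel_tree_of_order[OF C(1) n] parent_rel_tree_of_order[OF C(2) n]
      by (intro set_eqI) (simp add: split_paired_all)
    then have "anc_rel (tree_of_order r) = anc_rel (tree_of_order s)" unfolding anc_rel_def by simp
    moreover have "in_ordered_tree (tree_of_order r)" "in_ordered_tree (tree_of_order s)"
      using C n tree_of_order_in_CTamTree CTamTree_iff by blast+
    ultimately have "tree_of_order r = tree_of_order s" by (intro in_ordered_tree_eqI)
    then show "r = s"
      using post_order_tree_of_order[OF C(1) n av(1)] post_order_tree_of_order[OF C(2) n av(2)]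
      by metis
  qed
  ultimately show ?thesis by (rule finite_imageD)
qed

lemma poset_isomorphic_finite: "poset_isomorphic A r B s \<Longrightarrow> finite A \<Longrightarrow> finite B"
  unfolding poset_isomorphic_def using bij_betw_finite by blast

theorem corollary4p11:
  fixes n :: int
  assumes "n \<ge> 2"
  shows "(finite (CTam312 n) \<and> self_dual (CTam312 n) (ctam312_order n)) \<and>
    (finite (CTam132 n) \<and> self_dual (CTam132 n) (ctam132_order n)) \<and>
    (finite (CTamTree n) \<and> self_dual (CTamTree n) (ctam_tree_order n)) \<and>
    poset_isomorphic (CTam312 n) (ctam312_order n) (CTam132 n) (ctam132_order n) \<and>
    poset_isomorphic (CTam312 n) (ctam312_order n) (CTamTree n) (ctam_tree_order n) \<and>
    poset_isomorphic (CTam132 n) (ctam132_order n) (CTamTree n) (ctam_tree_order n)"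
proof -
  have n: "n > 0" using assms by simp
  have iso_tree: "poset_isomorphic (CTam312 n) (ctam312_order n) (CTamTree n) (ctam_tree_order n)"
    using CTamTree_isomorphic_CTam312[OF n] by (rule poset_isomorphic_sym)
  have sd_312: "self_dual (CTam312 n) (ctam312_order n)"
    using self_dual_transfer[OF iso_tree self_dual_CTamTree] .
  have "poset_isomorphic (CTam312 n) ((ctam312_order n)\<inverse>) (CTam132 n) (ctam132_order n)"
    using poset_isomorphic_converse[OF CTam312_dual_CTam132] by simp
  then have iso_132: "poset_isomorphic (CTam312 n) (ctam312_order n) (CTam132 n) (ctam132_order n)"
    using sd_312 poset_isomorphic_trans unfolding self_dual_def by blast
  have sd_132: "self_dual (CTam132 n) (ctam132_order n)"
    using self_dual_transfer[OF poset_isomorphic_sym[OF iso_132] sd_312] .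
  have "poset_isomorphic (CTam132 n) (ctam132_order n) (CTamTree n) (ctam_tree_order n)"
    using poset_isomorphic_trans[OF poset_isomorphic_sym[OF iso_132] iso_tree] .
  moreover have "finite (CTam132 n)" "finite (CTamTree n)"
    using iso_132 iso_tree finite_CTam312[OF n] poset_isomorphic_finite by blast+
  ultimately show ?thesis
    using iso_132 iso_tree sd_312 sd_132 self_dual_CTamTree finite_CTam312[OF n] by simp
qed

end
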